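(* Let $G_1,\ldots,G_n$ be nondeterministic automata, where $G_i$ has set of secret states $Q_i^S$, and consider the composed system $G_1\|\cdots\|G_n$ with interaction $\|_\lor$, i.e. with set of secret states $Q^S=Q\setminus(Q_1^{NS}\times\cdots\times Q_n^{NS})$, $Q_i^{NS}=Q_i\setminus Q_i^S$. For $1\le i\le n$ let $H_i$ be the two-way observer of $G_i$ with state set $X_{H_i}$, and let $H_{i,\psi_i}$ be its $\psi_i$-automaton with set of $\psi_i$-states $X^i_{\psi_i}=\{(X^i,X^i_R)\in X_{H_i}: X^i\cap X^i_R\subseteq Q_i^S\}$, where $\psi_1,\ldots,\psi_n$ are pairwise distinct new events. If $H_{1,\psi_1}\|\cdots\|H_{n,\psi_n}$ is nonblocking, then $G_1\|\cdots\|G_n$ is infinite-step opaque.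
   Context: An automaton is $G=\langle\Sigma_\tau,Q,\to,Q^\circ\rangle$ with finite set $\Sigma$ of observable events, a special unobservable event $\tau\notin\Sigma$, $\Sigma_\tau=\Sigma\cup\{\tau\}$, finite states $Q$, transitions $\to\subseteq Q\times\Sigma_\tau\times Q$, initial states $Q^\circ$, possibly marked states, and secret states $Q^S\subseteq Q$, $Q^{NS}=Q\setminus Q^S$. For $s\in\Sigma^*$, $p\stackrel{s}{\Rightarrow}q$ means there is $t\in\Sigma_\tau^*$ which becomes $s$ after deleting all $\tau$'s and $p\stackrel{t}{\to}q$; $p\stackrel{s}{\Rightarrow}$ means this for some $q$; $L(G,q)=\{s:q\stackrel{s}{\Rightarrow}\}$. Synchronous composition: states are tuples, initial (resp. marked) states are products of initial (resp. marked) states; a shared event (other than $\tau$, never shared) is executed jointly by all components having it in their alphabet; other events are executed by a single component while the others stay put. Infinite-step opacity: $G$ is infinite-step opaque w.r.t. $Q^S$ iff for every $q^\circ\in Q^\circ$ and all $s,t\in\Sigma^*$ with $st\in L(G,q^\circ)$ and $q^\circ\stackrel{s}{\Rightarrow}Q^S$, there exist $q'^\circ\in Q^\circ$ and $y\in Q^{NS}$ with $q'^\circ\stackrel{s}{\Rightarrow}y$ and $y\stackrel{t}{\Rightarrow}$. Reversed automaton: $G_R=\langle\Sigma_\tau,Q,\to_R,Q\rangle$ with $(x,\sigma,y)\in\to_R$ iff $y\stackrel{\sigma}{\to}x$, all states initial. Current-state estimator: $UR(B)$ is the set of states reachable from $B$ by strings in $\{\tau\}^*$; $det(G)$ is the deterministic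 automaton over $\Sigma$ with initial state $UR(Q^\circ)$ and transitions $X\stackrel{\sigma}{\to}Y$ where $Y=\bigcup\{UR(\{y\}): x\stackrel{\sigma}{\to}y, x\in X\}$ is nonempty; only reachable states are kept. Two-way observer: with renamings $\Delta(\sigma)=(\sigma,\epsilon)$, $\Delta_R(\sigma)=(\epsilon,\sigma)$ relabelling transitions, $H_i=\Delta(det(G_i))\|\Delta_R(det(G_{i,R}))$, a deterministic automaton over $\Delta(\Sigma_i)\cup\Delta_R(\Sigma_i)$ with reachable states $(X^i,X^i_R)$, $X^i,X^i_R\subseteq Q_i$. $\psi$-automaton: for a deterministic automaton $D=\langle\Sigma,Q_D,\to,q^\circ\rangle$, set $X_\psi\subseteq Q_D$ and new event $\psi$, $D_\psi=\langle\Sigma\cup\{\psi\},Q_D\cup\{\bot\},\to\cup\{(x,\psi,\bot):x\in X_\psi\},q^\circ,Q_D\rangle$, with $\bot$ a new unmarked state and all original states marked. An automaton is nonblocking if from every reachable state some marked state is reachable; otherwise blocking. *)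

theory Defs
  imports Main "HOL-Library.FuncSet"
begin

text \<open>In transition labels, \<open>None\<close> is the unobservable event \<open>\<tau>\<close> and \<open>Some \<sigma>\<close> the observable
  event \<open>\<sigma>\<close>; the field \<open>alphabet\<close> is \<open>\<Sigma>\<close>, without \<open>\<tau>\<close>.\<close>

record ('e, 'q) automaton =
  alphabet :: "'e set"
  states :: "'q set"
  transitions :: "('q \<times> 'e option \<times> 'q) set"
  initial :: "'q set"
  marked :: "'q set"

definition is_automaton :: "('e, 'q) automaton \<Rightarrow> bool" where
  "is_automaton G \<longleftrightarrow>
     finite (alphabet G) \<and> finite (states G) \<and>
     transitions G \<subseteq> states G \<times> insert None (Some ` alphabet G) \<times> states G \<and>
     initial G \<subseteq> states G \<and> marked G \<subseteq> states G"

inductive run :: "('e, 'q) automaton \<Rightarrow> 'q \<Rightarrow> 'e option list \<Rightarrow> 'q \<Rightarrow> bool"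
  for G :: "('e, 'q) automaton" where
  run_Nil: "run G p [] p"
| run_Cons: "(p, l, r) \<in> transitions G \<Longrightarrow> run G r t q \<Longrightarrow> run G p (l # t) q"

fun delete_tau :: "'e option list \<Rightarrow> 'e list" where
  "delete_tau [] = []"
| "delete_tau (None # t) = delete_tau t"
| "delete_tau (Some \<sigma> # t) = \<sigma> # delete_tau t"

definition weak_run :: "('e, 'q) automaton \<Rightarrow> 'q \<Rightarrow> 'e list \<Rightarrow> 'q \<Rightarrow> bool" where
  "weak_run G p s q \<longleftrightarrow> (\<exists>t. delete_tau t = s \<and> run G p t q)"

definition language :: "('e, 'q) automaton \<Rightarrow> 'q \<Rightarrow> 'e list set" where
  "language G p = {s. \<exists>q. weak_run G p s q}"

definition reachable_states :: "('e, 'q) automaton \<Rightarrow> 'q set" where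
  "reachable_states G = {q. \<exists>p \<in> initial G. \<exists>t. run G p t q}"

definition accessible_part :: "('e, 'q) automaton \<Rightarrow> ('e, 'q) automaton" where
  "accessible_part G =
     \<lparr> alphabet = alphabet G,
       states = states G \<inter> reachable_states G,
       transitions = {(x, l, y) \<in> transitions G. x \<in> reachable_states G},
       initial = initial G,
       marked = marked G \<inter> reachable_states G \<rparr>"

definition nonblocking :: "('e, 'q) automaton \<Rightarrow> bool" where
  "nonblocking G \<longleftrightarrow> (\<forall>q \<in> reachable_states G. \<exists>m \<in> marked G. \<exists>t. run G q t m)"

text \<open>Composition of a family over an index set, with extensional functions as tuples.\<close>

definition sync :: "'i set \<Rightarrow> ('i \<Rightarrow> ('e, 'q) automaton) \<Rightarrow> ('e, 'i \<Rightarrow> 'q) automaton" where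
  "sync I A =
     \<lparr> alphabet = (\<Union>i\<in>I. alphabet (A i)),
       states = (\<Pi>\<^sub>E i\<in>I. states (A i)),
       transitions =
         {(x, Some \<sigma>, y) | x \<sigma> y.
            x \<in> (\<Pi>\<^sub>E i\<in>I. states (A i)) \<and> y \<in> (\<Pi>\<^sub>E i\<in>I. states (A i)) \<and>
            \<sigma> \<in> (\<Union>i\<in>I. alphabet (A i)) \<and>
            (\<forall>i\<in>I. if \<sigma> \<in> alphabet (A i) then (x i, Some \<sigma>, y i) \<in> transitions (A i)
                   else y i = x i)} \<union>
         {(x, None, y) | x y.
            x \<in> (\<Pi>\<^sub>E i\<in>I. states (A i)) \<and> y \<in> (\<Pi>\<^sub>E i\<in>I. states (A i)) \<and>
            (\<exists>i\<in>I. (x i, None, y i) \<in> transitions (A i) \<and> (\<forall>j\<in>I - {i}. y j = x j))},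
       initial = (\<Pi>\<^sub>E i\<in>I. initial (A i)),
       marked = (\<Pi>\<^sub>E i\<in>I. marked (A i)) \<rparr>"

text \<open>The same composition for two automata whose state types may differ.\<close>

definition sync2 :: "('e, 'p) automaton \<Rightarrow> ('e, 'q) automaton \<Rightarrow> ('e, 'p \<times> 'q) automaton" where
  "sync2 A B =
     \<lparr> alphabet = alphabet A \<union> alphabet B,
       states = states A \<times> states B,
       transitions =
         {((x, u), Some \<sigma>, (y, v)) | x u \<sigma> y v. \<sigma> \<in> alphabet A \<inter> alphabet B \<and>
            (x, Some \<sigma>, y) \<in> transitions A \<and> (u, Some \<sigma>, v) \<in> transitions B} \<union>
         {((x, u), l, (y, u)) | x u l y. l \<notin> Some ` alphabet B \<and>
            (x, l, y) \<in> transitions A \<and> u \<in> states B} \<union>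
         {((x, u), l, (x, v)) | x u l v. l \<notin> Some ` alphabet A \<and>
            (u, l, v) \<in> transitions B \<and> x \<in> states A},
       initial = initial A \<times> initial B,
       marked = marked A \<times> marked B \<rparr>"

definition infinite_step_opaque :: "('e, 'q) automaton \<Rightarrow> 'q set \<Rightarrow> bool" where
  "infinite_step_opaque G QS \<longleftrightarrow>
     (\<forall>q0 \<in> initial G. \<forall>s \<in> lists (alphabet G). \<forall>t \<in> lists (alphabet G).
        s @ t \<in> language G q0 \<and> (\<exists>q \<in> QS. weak_run G q0 s q) \<longrightarrow>
        (\<exists>q0' \<in> initial G. \<exists>y \<in> states G - QS. weak_run G q0' s y \<and> (\<exists>z. weak_run G y t z)))"

text \<open>The reversed automaton and the current-state estimator carry no marking. Their field
  \<open>marked\<close> is set to the empty set; the \<open>\<psi>\<close>-automaton below ignores it.\<close>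

definition reversed :: "('e, 'q) automaton \<Rightarrow> ('e, 'q) automaton" where
  "reversed G =
     \<lparr> alphabet = alphabet G,
       states = states G,
       transitions = {(x, l, y). (y, l, x) \<in> transitions G},
       initial = states G,
       marked = {} \<rparr>"

definition unobservable_reach :: "('e, 'q) automaton \<Rightarrow> 'q set \<Rightarrow> 'q set" where
  "unobservable_reach G B = {q. \<exists>p \<in> B. \<exists>t \<in> lists {None}. run G p t q}"

definition observer_step :: "('e, 'q) automaton \<Rightarrow> 'q set \<Rightarrow> 'e \<Rightarrow> 'q set" where
  "observer_step G X \<sigma> =
     \<Union> {unobservable_reach G {y} | x y. x \<in> X \<and> (x, Some \<sigma>, y) \<in> transitions G}"

definition det :: "('e, 'q) automaton \<Rightarrow> ('e, 'q set) automaton" where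
  "det G = accessible_part
     \<lparr> alphabet = alphabet G,
       states = Pow (states G),
       transitions = {(X, Some \<sigma>, Y) | X \<sigma> Y. X \<in> Pow (states G) \<and> \<sigma> \<in> alphabet G \<and>
                        Y = observer_step G X \<sigma> \<and> Y \<noteq> {}},
       initial = {unobservable_reach G (initial G)},
       marked = {} \<rparr>"

definition rename_events :: "('e \<Rightarrow> 'f) \<Rightarrow> ('e, 'q) automaton \<Rightarrow> ('f, 'q) automaton" where
  "rename_events f G =
     \<lparr> alphabet = f ` alphabet G,
       states = states G,
       transitions = {(x, map_option f l, y) | x l y. (x, l, y) \<in> transitions G},
       initial = initial G,
       marked = marked G \<rparr>"

text \<open>The events \<open>(\<sigma>, \<epsilon>)\<close> and \<open>(\<epsilon>, \<sigma>)\<close> are pairs of strings, with \<open>\<epsilon>\<close> the empty one.\<close>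

definition Delta :: "'e \<Rightarrow> 'e list \<times> 'e list" where
  "Delta \<sigma> = ([\<sigma>], [])"

definition Delta_R :: "'e \<Rightarrow> 'e list \<times> 'e list" where
  "Delta_R \<sigma> = ([], [\<sigma>])"

definition two_way_observer ::
  "('e, 'q) automaton \<Rightarrow> ('e list \<times> 'e list, 'q set \<times> 'q set) automaton" where
  "two_way_observer G = accessible_part
     (sync2 (rename_events Delta (det G)) (rename_events Delta_R (det (reversed G))))"

text \<open>The new event is \<open>Inr \<psi>\<close>, fresh for the original events \<open>Inl \<sigma>\<close>; the new state \<open>\<bottom>\<close> is
  \<open>None\<close>.\<close>

definition psi_automaton ::
  "('e, 'q) automaton \<Rightarrow> 'q set \<Rightarrow> 'p \<Rightarrow> ('e + 'p, 'q option) automaton" where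
  "psi_automaton D P \<psi> =
     \<lparr> alphabet = insert (Inr \<psi>) (Inl ` alphabet D),
       states = insert None (Some ` states D),
       transitions =
         {(Some x, map_option Inl l, Some y) | x l y. (x, l, y) \<in> transitions D} \<union>
         {(Some x, Some (Inr \<psi>), None) | x. x \<in> P},
       initial = Some ` initial D,
       marked = Some ` states D \<rparr>"

definition psi_states :: "('e, 'q) automaton \<Rightarrow> 'q set \<Rightarrow> ('q set \<times> 'q set) set" where
  "psi_states G QS = {(X, XR) \<in> states (two_way_observer G). X \<inter> XR \<subseteq> QS}"

text \<open>Secret states of the composition under the interaction \<open>\<parallel>\<^sub>\<or>\<close>: at least one component is in
  a secret state.\<close>

definition secret_or :: "'i set \<Rightarrow> ('i \<Rightarrow> ('e, 'q) automaton) \<Rightarrow> ('i \<Rightarrow> 'q set) \<Rightarrow> ('i \<Rightarrow> 'q) set"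
  where
  "secret_or I G QS = states (sync I G) - (\<Pi>\<^sub>E i\<in>I. states (G i) - QS i)"

end

theory Submission
  imports Defs
begin

text \<open>Suppose the composition does \<open>s\<close> and then \<open>t\<close>, and project both strings to the component
  alphabets, giving \<open>s\<^sub>i\<close> and \<open>t\<^sub>i\<close>. The two-way observer of \<open>G\<^sub>i\<close> reads \<open>s\<^sub>i\<close> forwards and \<open>t\<^sub>i\<close>
  backwards and reaches the pair \<open>(X, X\<^sub>R)\<close> of the states reached by \<open>s\<^sub>i\<close> and the states that enable
  \<open>t\<^sub>i\<close>. These runs synchronise, so if \<open>X \<inter> X\<^sub>R\<close> consisted of secret states for some \<open>i\<close>, the event
  \<open>\<psi>\<^sub>i\<close> could follow and lead to a tuple with \<open>i\<close>-th entry \<open>\<bottom>\<close>, from which no marked state is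
  reachable. Nonblockingness thus yields in each component a nonsecret state reached by \<open>s\<^sub>i\<close> and
  enabling \<open>t\<^sub>i\<close>, and the tuple of these states witnesses opacity.\<close>

subsection \<open>Weak runs\<close>

lemma delete_tau_eq_Nil_iff: "delete_tau t = [] \<longleftrightarrow> t \<in> lists {None}"
  by (induction t rule: delete_tau.induct) auto

lemma weak_run_refl [simp]: "weak_run G p [] p"
  unfolding weak_run_def using run_Nil by (metis delete_tau.simps(1))

lemma weak_run_tau: "(p, None, r) \<in> transitions G \<Longrightarrow> weak_run G r s q \<Longrightarrow> weak_run G p s q"
  unfolding weak_run_def using run_Cons by (metis delete_tau.simps(2))

lemma weak_run_event:
  "(p, Some \<sigma>, r) \<in> transitions G \<Longrightarrow> weak_run G r s q \<Longrightarrow> weak_run G p (\<sigma> # s) q"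
  unfolding weak_run_def using run_Cons by (metis delete_tau.simps(3))

text \<open>Induction on the underlying run, with the string containing taus hidden once and for
  all: later proofs see only silent and observable steps.\<close>

lemma weak_run_induct [consumes 1, case_names Nil tau event]:
  assumes "weak_run G p s q"
    and "\<And>p. P p [] p"
    and "\<And>p r s q. (p, None, r) \<in> transitions G \<Longrightarrow> weak_run G r s q \<Longrightarrow> P r s q \<Longrightarrow> P p s q"
    and "\<And>p \<sigma> r s q. (p, Some \<sigma>, r) \<in> transitions G \<Longrightarrow> weak_run G r s q \<Longrightarrow> P r s q \<Longrightarrow>
           P p (\<sigma> # s) q"
  shows "P p s q"
proof -
  obtain t where "run G p t q" and s: "s = delete_tau t"
    using assms(1) by (auto simp: weak_run_def)
  from this(1) have "P p (delete_tau t) q"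
  proof induction
    case (run_Nil p)
    show ?case by (simp add: assms(2))
  next
    case (run_Cons p l r t q)
    then have "weak_run G r (delete_tau t) q" by (auto simp: weak_run_def)
    with run_Cons show ?case by (cases l) (auto intro: assms(3,4))
  qed
  with s show ?thesis by simp
qed

lemma weak_run_trans:
  "weak_run G p s q \<Longrightarrow> weak_run G q t r \<Longrightarrow> weak_run G p (s @ t) r"
  by (induction rule: weak_run_induct) (auto intro: weak_run_tau weak_run_event)

text \<open>Taus before the first observable event go into the run to \<open>u\<close>; those after
  it stay in the run from \<open>v\<close>.\<close>

lemma weak_run_ConsE:
  assumes "weak_run G p (\<sigma> # s) q"
  obtains u v where "weak_run G p [] u" "(u, Some \<sigma>, v) \<in> transitions G" "weak_run G v s q"
proof -
  have "weak_run G p w q \<Longrightarrow> w = \<sigma> # s \<Longrightarrow>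
      \<exists>u v. weak_run G p [] u \<and> (u, Some \<sigma>, v) \<in> transitions G \<and> weak_run G v s q" for w
  proof (induction rule: weak_run_induct)
    case (tau p r w q)
    then show ?case by (blast intro: weak_run_tau)
  next
    case (event p \<rho> r w q)
    then show ?case by (intro exI[of _ p] exI[of _ r]) simp
  qed simp
  with assms that show thesis by blast
qed

lemma weak_run_append_iff:
  "weak_run G p (s @ t) q \<longleftrightarrow> (\<exists>r. weak_run G p s r \<and> weak_run G r t q)"
proof
  show "weak_run G p (s @ t) q \<Longrightarrow> \<exists>r. weak_run G p s r \<and> weak_run G r t q"
  proof (induction s arbitrary: p)
    case Nil
    then show ?case using weak_run_refl by fastforce
  next
    case (Cons \<sigma> s)
    then obtain u v where u: "weak_run G p [] u" "(u, Some \<sigma>, v) \<in> transitions G"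
      and "weak_run G v (s @ t) q" by (auto elim: weak_run_ConsE)
    then obtain r where "weak_run G v s r" "weak_run G r t q" using Cons.IH by blast
    with u show ?case using weak_run_trans[OF u(1) weak_run_event[OF u(2)]] by auto
  qed
qed (auto intro: weak_run_trans)

text \<open>Here the final taus are split off after the last event, matching the estimator step: an
  observable transition followed by an unobservable reach.\<close>

lemma weak_run_snoc_iff:
  "weak_run G p (s @ [\<sigma>]) q \<longleftrightarrow>
     (\<exists>u v. weak_run G p s u \<and> (u, Some \<sigma>, v) \<in> transitions G \<and> weak_run G v [] q)"
proof
  assume "weak_run G p (s @ [\<sigma>]) q"
  then obtain r where r: "weak_run G p s r" "weak_run G r [\<sigma>] q"
    by (auto simp: weak_run_append_iff)
  from r(2) obtain u v where "weak_run G r [] u" "(u, Some \<sigma>, v) \<in> transitions G"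
      "weak_run G v [] q" by (elim weak_run_ConsE)
  then show "\<exists>u v. weak_run G p s u \<and> (u, Some \<sigma>, v) \<in> transitions G \<and> weak_run G v [] q"
    using weak_run_trans[OF r(1), of "[]"] by auto
qed (auto intro: weak_run_trans weak_run_event)

section \<open>Reachability and state membership along runs\<close>

lemma reachable_states_iff_weak_run:
  "q \<in> reachable_states G \<longleftrightarrow> (\<exists>p \<in> initial G. \<exists>s. weak_run G p s q)"
  by (auto simp: reachable_states_def weak_run_def)

lemma reachable_states_step:
  "p \<in> reachable_states G \<Longrightarrow> (p, l, q) \<in> transitions G \<Longrightarrow> q \<in> reachable_states G"
  unfolding reachable_states_iff_weak_run
  by (cases l) (blast intro: weak_run_trans weak_run_tau weak_run_event weak_run_refl)+

lemma initial_reachable_states: "p \<in> initial G \<Longrightarrow> p \<in> reachable_states G"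
  unfolding reachable_states_def using run_Nil by fast

text \<open>The part of \<open>is_automaton\<close> that carries state membership along runs; it is
  passed through each construction up to the \<open>\<psi>\<close>-automaton.\<close>

definition closed_transitions :: "('e, 'q) automaton \<Rightarrow> bool" where
  "closed_transitions G \<longleftrightarrow> (\<forall>(x, l, y) \<in> transitions G. x \<in> states G \<and> y \<in> states G)"

lemma is_automaton_closed_transitions: "is_automaton G \<Longrightarrow> closed_transitions G"
  by (auto simp: is_automaton_def closed_transitions_def)

lemma weak_run_states:
  "weak_run G p s q \<Longrightarrow> closed_transitions G \<Longrightarrow> p \<in> states G \<Longrightarrow> q \<in> states G"
  by (induction rule: weak_run_induct) (auto simp: closed_transitions_def)

subsection \<open>Constructions on automata\<close>

text \<open>All states on a run from a reachable state are reachable, so none of its transitions is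
  removed.\<close>

lemma weak_run_accessible_part:
  "weak_run G p s q \<Longrightarrow> p \<in> reachable_states G \<Longrightarrow> weak_run (accessible_part G) p s q"
proof (induction rule: weak_run_induct)
  case (tau p r s q)
  then show ?case
    by (intro weak_run_tau[of p r]) (auto simp: accessible_part_def intro: reachable_states_step)
next
  case (event p \<sigma> r s q)
  then show ?case
    by (intro weak_run_event[of p \<sigma> r]) (auto simp: accessible_part_def intro: reachable_states_step)
qed simp

lemma closed_transitions_accessible_part:
  "closed_transitions G \<Longrightarrow> closed_transitions (accessible_part G)"
  by (auto simp: closed_transitions_def accessible_part_def intro: reachable_states_step)

lemma weak_run_rename_events:
  "weak_run G p s q \<Longrightarrow> weak_run (rename_events f G) p (map f s) q"
  by (induction rule: weak_run_induct)
    (force simp: rename_events_def intro: weak_run_tau weak_run_event)+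

lemma closed_transitions_rename_events:
  "closed_transitions G \<Longrightarrow> closed_transitions (rename_events f G)"
  by (auto simp: closed_transitions_def rename_events_def)

text \<open>Events foreign to \<open>B\<close>, and tau, move \<open>A\<close> alone. With the
  mirrored lemma below, runs over disjoint alphabets can be executed one after the other.\<close>

lemma weak_run_sync2_left:
  "weak_run A p s q \<Longrightarrow> set s \<inter> alphabet B = {} \<Longrightarrow> u \<in> states B \<Longrightarrow>
     weak_run (sync2 A B) (p, u) s (q, u)"
proof (induction rule: weak_run_induct)
  case (tau p r s q)
  then show ?case by (intro weak_run_tau[of "(p, u)" "(r, u)"]) (auto simp: sync2_def)
next
  case (event p \<sigma> r s q)
  then show ?case by (intro weak_run_event[of "(p, u)" \<sigma> "(r, u)"]) (auto simp: sync2_def)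
qed simp

lemma weak_run_sync2_right:
  "weak_run B p s q \<Longrightarrow> set s \<inter> alphabet A = {} \<Longrightarrow> u \<in> states A \<Longrightarrow>
     weak_run (sync2 A B) (u, p) s (u, q)"
proof (induction rule: weak_run_induct)
  case (tau p r s q)
  then show ?case by (intro weak_run_tau[of "(u, p)" "(u, r)"]) (auto simp: sync2_def)
next
  case (event p \<sigma> r s q)
  then show ?case by (intro weak_run_event[of "(u, p)" \<sigma> "(u, r)"]) (auto simp: sync2_def)
qed simp

lemma closed_transitions_sync2:
  "closed_transitions A \<Longrightarrow> closed_transitions B \<Longrightarrow> closed_transitions (sync2 A B)"
  unfolding closed_transitions_def sync2_def by fastforce

lemma weak_run_psi_automaton:
  "weak_run D p s q \<Longrightarrow> weak_run (psi_automaton D P \<psi>) (Some p) (map Inl s) (Some q)"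
proof (induction rule: weak_run_induct)
  case (tau p r s q)
  then show ?case by (intro weak_run_tau[of "Some p" "Some r"]) (force simp: psi_automaton_def)+
next
  case (event p \<sigma> r s q)
  then show ?case
    by (simp, intro weak_run_event[of "Some p" "Inl \<sigma>" "Some r"]) (force simp: psi_automaton_def)+
qed simp

text \<open>The source of every transition has the form \<open>Some x\<close>, so
  \<open>\<bottom>\<close> cannot be left. As it is also unmarked, entering it blocks.\<close>

lemma weak_run_psi_automaton_None:
  "weak_run (psi_automaton D P \<psi>) x s q \<Longrightarrow> x = None \<Longrightarrow> q = None"
  by (induction rule: weak_run_induct) (auto simp: psi_automaton_def)

lemma closed_transitions_psi_automaton:
  "closed_transitions D \<Longrightarrow> P \<subseteq> states D \<Longrightarrow> closed_transitions (psi_automaton D P \<psi>)"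
  by (auto simp: closed_transitions_def psi_automaton_def)

section \<open>Reversal of runs\<close>

lemma weak_run_reversed: "weak_run G p s q \<Longrightarrow> weak_run (reversed G) q (rev s) p"
proof (induction rule: weak_run_induct)
  case (tau p r s q)
  have "weak_run (reversed G) r [] p"
    using tau by (intro weak_run_tau[of r p]) (auto simp: reversed_def)
  with tau.IH show ?case using weak_run_trans by fastforce
next
  case (event p \<sigma> r s q)
  have "weak_run (reversed G) r [\<sigma>] p"
    using event by (intro weak_run_event[of r \<sigma> p]) (auto simp: reversed_def)
  with event.IH show ?case by (auto intro: weak_run_trans)
qed simp

lemma reversed_reversed_transitions: "transitions (reversed (reversed G)) = transitions G"
  by (auto simp: reversed_def)

lemma weak_run_cong_transitions:
  "weak_run G p s q \<Longrightarrow> transitions G = transitions G' \<Longrightarrow> weak_run G' p s q"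
  by (induction rule: weak_run_induct) (auto intro: weak_run_tau weak_run_event)

text \<open>The converse direction reverses twice. Double reversal restores the transitions but in
  general not the initial and marked states, hence the transfer along equal transitions.\<close>

lemma weak_run_reversed_iff: "weak_run (reversed G) p s q \<longleftrightarrow> weak_run G q (rev s) p"
  using weak_run_reversed[of G q "rev s" p]
    weak_run_cong_transitions[OF weak_run_reversed[of "reversed G" p s q]
      reversed_reversed_transitions]
  by auto

subsection \<open>State estimates\<close>

text \<open>Direct description, through runs of \<open>G\<close>, of the state that
  \<open>det G\<close> reaches on \<open>s\<close>; it is empty when no initial state can execute
  \<open>s\<close>.\<close>

definition estimate :: "('e, 'q) automaton \<Rightarrow> 'e list \<Rightarrow> 'q set" where
  "estimate G s = {q. \<exists>p \<in> initial G. weak_run G p s q}"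

lemma unobservable_reach_eq: "unobservable_reach G B = {q. \<exists>p \<in> B. weak_run G p [] q}"
  by (auto simp: unobservable_reach_def weak_run_def delete_tau_eq_Nil_iff)

lemma observer_step_estimate: "observer_step G (estimate G s) \<sigma> = estimate G (s @ [\<sigma>])"
  unfolding observer_step_def unobservable_reach_eq estimate_def weak_run_snoc_iff by blast

lemma estimate_subset_states:
  "closed_transitions G \<Longrightarrow> initial G \<subseteq> states G \<Longrightarrow> estimate G s \<subseteq> states G"
  by (auto simp: estimate_def intro: weak_run_states)

lemma initial_det: "initial (det G) = {estimate G []}"
  by (simp add: det_def accessible_part_def unobservable_reach_eq estimate_def)

lemma states_det_estimate_Nil:
  assumes "closed_transitions G" "initial G \<subseteq> states G"
  shows "estimate G [] \<in> states (det G)"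
  using estimate_subset_states[OF assms]
  by (auto simp: det_def accessible_part_def unobservable_reach_eq estimate_def
      intro!: initial_reachable_states)

text \<open>Estimates follow \<open>observer_step\<close>. Nonemptiness of the last one is required
  because \<open>det\<close> has no transitions into the empty set.\<close>

lemma weak_run_det:
  assumes "closed_transitions G" "initial G \<subseteq> states G"
    and "set s \<subseteq> alphabet G" "estimate G s \<noteq> {}"
  shows "weak_run (det G) (estimate G []) s (estimate G s)"
proof -
  \<comment> \<open>The automaton inside \<open>det\<close>, before restriction to its accessible
    part: the run is built here and transferred at the end.\<close>
  let ?D = "\<lparr> alphabet = alphabet G, states = Pow (states G),
       transitions = {(X, Some \<sigma>, Y) | X \<sigma> Y. X \<in> Pow (states G) \<and> \<sigma> \<in> alphabet G \<and>
                        Y = observer_step G X \<sigma> \<and> Y \<noteq> {}},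
       initial = {unobservable_reach G (initial G)}, marked = {} \<rparr>"
  have "weak_run ?D (estimate G []) s (estimate G s)"
    using assms(3,4)
  proof (induction s rule: rev_induct)
    case (snoc \<sigma> s)
    \<comment> \<open>A run on the longer string passes through a state reached by
      \<open>s\<close>.\<close>
    have "estimate G s \<noteq> {}"
      using snoc.prems(2) by (auto simp: estimate_def weak_run_append_iff)
    with snoc have "weak_run ?D (estimate G []) s (estimate G s)" by simp
    moreover have "(estimate G s, Some \<sigma>, estimate G (s @ [\<sigma>])) \<in> transitions ?D"
      using snoc.prems estimate_subset_states[OF assms(1,2)]
      by (simp add: observer_step_estimate)
    ultimately show ?case
      by (blast intro: weak_run_trans weak_run_event weak_run_refl)
  qed simp
  moreover have "estimate G [] \<in> reachable_states ?D"
    by (rule initial_reachable_states) (simp add: unobservable_reach_eq estimate_def)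
  ultimately show ?thesis
    unfolding det_def by (rule weak_run_accessible_part)
qed

lemma closed_transitions_det:
  assumes "closed_transitions G"
  shows "closed_transitions (det G)"
proof -
  \<comment> \<open>The definition of \<open>det\<close> bounds only the sources of transitions
    explicitly; this bounds the targets.\<close>
  have "observer_step G X \<sigma> \<subseteq> states G" for X \<sigma>
    using assms by (fastforce simp: observer_step_def unobservable_reach_eq closed_transitions_def
        dest: weak_run_states[OF _ assms])
  then show ?thesis
    unfolding det_def
    by (intro closed_transitions_accessible_part) (auto simp: closed_transitions_def)
qed

lemma alphabet_det [simp]: "alphabet (det G) = alphabet G"
  by (simp add: det_def accessible_part_def)

lemma reversed_simps [simp]:
  "alphabet (reversed G) = alphabet G" "states (reversed G) = states G"
  "initial (reversed G) = states G"
  by (simp_all add: reversed_def)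

lemma closed_transitions_reversed:
  "closed_transitions G \<Longrightarrow> closed_transitions (reversed G)"
  by (auto simp: closed_transitions_def reversed_def)

text \<open>Since all states are initial in the reversed automaton, reading \<open>t\<close>
  backwards yields exactly the states from which \<open>t\<close> can be executed to some state
  \<open>z\<close>.\<close>

lemma estimate_reversed:
  "estimate (reversed G) (rev t) = {q. \<exists>z \<in> states G. weak_run G q t z}"
  by (simp add: estimate_def weak_run_reversed_iff)

section \<open>The two-way observer\<close>

lemma closed_transitions_two_way_observer:
  "closed_transitions G \<Longrightarrow> closed_transitions (two_way_observer G)"
  unfolding two_way_observer_def
  by (intro closed_transitions_accessible_part closed_transitions_sync2
      closed_transitions_rename_events closed_transitions_det closed_transitions_reversed)

lemma alphabet_two_way_observer:
  "alphabet (two_way_observer G) = Delta ` alphabet G \<union> Delta_R ` alphabet G"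
  by (simp add: two_way_observer_def accessible_part_def sync2_def rename_events_def)

lemma initial_two_way_observer:
  "initial (two_way_observer G) = {(estimate G [], estimate (reversed G) [])}"
  by (simp add: two_way_observer_def accessible_part_def sync2_def rename_events_def initial_det)

lemma initial_two_way_observer_states:
  assumes "closed_transitions G" "initial G \<subseteq> states G"
  shows "(estimate G [], estimate (reversed G) []) \<in> states (two_way_observer G)"
  using states_det_estimate_Nil[OF assms]
    states_det_estimate_Nil[OF closed_transitions_reversed[OF assms(1)]]
  by (auto simp: two_way_observer_def accessible_part_def sync2_def rename_events_def initial_det
      intro!: initial_reachable_states)

text \<open>The events of \<open>Delta\<close> and \<open>Delta_R\<close> are disjoint, so the
  forward estimator can read all of \<open>s\<close> first and the backward one then reads
  \<open>rev t\<close>.\<close>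

lemma weak_run_two_way_observer:
  assumes closed: "closed_transitions G" "initial G \<subseteq> states G"
    and alph: "set s \<subseteq> alphabet G" "set t \<subseteq> alphabet G"
    and ne: "estimate G s \<noteq> {}" "estimate (reversed G) (rev t) \<noteq> {}"
  shows "weak_run (two_way_observer G) (estimate G [], estimate (reversed G) [])
           (map Delta s @ map Delta_R (rev t)) (estimate G s, estimate (reversed G) (rev t))"
proof -
  let ?A = "rename_events Delta (det G)" and ?B = "rename_events Delta_R (det (reversed G))"
  let ?x = "(estimate G [], estimate (reversed G) [])"
  have closedR: "closed_transitions (reversed G)" "initial (reversed G) \<subseteq> states (reversed G)"
    using closed by (auto intro: closed_transitions_reversed)
  have A: "weak_run ?A (estimate G []) (map Delta s) (estimate G s)"
    by (intro weak_run_rename_events weak_run_det closed alph ne)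
  have B: "weak_run ?B (estimate (reversed G) []) (map Delta_R (rev t))
      (estimate (reversed G) (rev t))"
    using alph ne by (intro weak_run_rename_events weak_run_det closedR) auto
  have "estimate G [] \<in> states ?A" "estimate (reversed G) [] \<in> states ?B"
    using states_det_estimate_Nil[OF closed] states_det_estimate_Nil[OF closedR]
    by (auto simp: rename_events_def)
  \<comment> \<open>The left component rests here while the right one moves, which
    \<open>sync2\<close> permits only at a state of \<open>?A\<close>.\<close>
  moreover from this(1) have "estimate G s \<in> states ?A"
    using A closed by (blast intro: weak_run_states closed_transitions_rename_events
        closed_transitions_det)
  moreover have "set (map Delta s) \<inter> alphabet ?B = {}" "set (map Delta_R (rev t)) \<inter> alphabet ?A = {}"
    by (auto simp: rename_events_def Delta_def Delta_R_def)
  ultimately have "weak_run (sync2 ?A ?B) ?x (map Delta s @ map Delta_R (rev t))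
      (estimate G s, estimate (reversed G) (rev t))"
    using A B by (intro weak_run_trans[OF weak_run_sync2_left weak_run_sync2_right])
  moreover have "?x \<in> reachable_states (sync2 ?A ?B)"
    by (rule initial_reachable_states) (simp add: sync2_def rename_events_def initial_det)
  ultimately show ?thesis
    unfolding two_way_observer_def by (rule weak_run_accessible_part)
qed

subsection \<open>Synchronous composition\<close>

text \<open>A composed step either is a step of component \<open>i\<close> or leaves it in place; a
  tau may belong to another component.\<close>

lemma weak_run_sync_project:
  assumes "weak_run (sync I A) x s y" "i \<in> I"
  shows "weak_run (A i) (x i) (filter (\<lambda>\<sigma>. \<sigma> \<in> alphabet (A i)) s) (y i)"
  using assms(1)
proof (induction rule: weak_run_induct)
  case (tau p r s q)
  then have "(p i, None, r i) \<in> transitions (A i) \<or> r i = p i"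
    using \<open>i \<in> I\<close> by (auto simp: sync_def)
  with tau.IH show ?case by (auto intro: weak_run_tau)
next
  case (event p \<sigma> r s q)
  then have "if \<sigma> \<in> alphabet (A i) then (p i, Some \<sigma>, r i) \<in> transitions (A i) else r i = p i"
    using \<open>i \<in> I\<close> by (auto simp: sync_def)
  with event.IH show ?case by (auto intro: weak_run_event split: if_splits)
qed simp

text \<open>Tau is never shared, so one component can move silently while the others wait. The
  separate equation \<open>s = []\<close> keeps the word a variable for the induction and excludes
  its event case.\<close>

lemma weak_run_sync_component:
  assumes "weak_run (A i) p s q" and "s = []" and closed: "closed_transitions (A i)" and "i \<in> I"
    and "x \<in> (\<Pi>\<^sub>E i\<in>I. states (A i))" and "x i = p"
  shows "weak_run (sync I A) x [] (x(i := q))"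
  using assms(1,2,5,6)
proof (induction arbitrary: x rule: weak_run_induct)
  case (Nil p)
  then show ?case by (metis fun_upd_triv weak_run_refl)
next
  case (tau p r s q)
  have "x(i := r) \<in> (\<Pi>\<^sub>E i\<in>I. states (A i))"
    using tau.prems tau.hyps closed \<open>i \<in> I\<close>
    by (auto simp: PiE_iff closed_transitions_def extensional_def)
  moreover from this have "(x, None, x(i := r)) \<in> transitions (sync I A)"
    using tau.prems tau.hyps \<open>i \<in> I\<close> by (auto simp: sync_def)
  ultimately show ?case
    using tau.IH[of "x(i := r)"] tau.prems(1) weak_run_tau by (metis fun_upd_same fun_upd_upd)
qed simp

lemma weak_run_sync_Nil:
  assumes "finite I" and closed: "\<And>i. i \<in> I \<Longrightarrow> closed_transitions (A i)"
    and x: "x \<in> (\<Pi>\<^sub>E i\<in>I. states (A i))" and y: "y \<in> (\<Pi>\<^sub>E i\<in>I. states (A i))"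
    and run: "\<And>i. i \<in> I \<Longrightarrow> weak_run (A i) (x i) [] (y i)"
  shows "weak_run (sync I A) x [] y"
proof -
  \<comment> \<open>The components move one at a time; \<open>J\<close> holds those that have
    already moved.\<close>
  have "weak_run (sync I A) x [] (\<lambda>i. if i \<in> J then y i else x i)" if "finite J" "J \<subseteq> I" for J
    using that
  proof (induction J rule: finite_induct)
    case (insert j J)
    let ?z = "\<lambda>i. if i \<in> J then y i else x i"
    have "?z \<in> (\<Pi>\<^sub>E i\<in>I. states (A i))"
      using x y by (auto simp: PiE_iff extensional_def)
    then have "weak_run (sync I A) ?z [] (?z(j := y j))"
      using insert run[of j] closed by (intro weak_run_sync_component[of A j "x j"]) auto
    moreover have "?z(j := y j) = (\<lambda>i. if i \<in> insert j J then y i else x i)" by auto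
    ultimately show ?case using insert weak_run_trans by fastforce
  qed simp
  from this[of I] have "weak_run (sync I A) x [] (\<lambda>i. if i \<in> I then y i else x i)"
    using \<open>finite I\<close> by simp
  moreover have "(\<lambda>i. if i \<in> I then y i else x i) = y"
    using x y by (auto simp: PiE_iff extensional_def)
  ultimately show ?thesis by simp
qed

text \<open>Converse of projection. For each letter, the components taking part first do their
  leading taus, interleaved by \<open>weak_run_sync_Nil\<close>, and then execute the letter
  jointly.\<close>

lemma weak_run_sync:
  assumes "finite I" and closed: "\<And>i. i \<in> I \<Longrightarrow> closed_transitions (A i)"
    and x: "x \<in> (\<Pi>\<^sub>E i\<in>I. states (A i))" and y: "y \<in> (\<Pi>\<^sub>E i\<in>I. states (A i))"
    and s: "set s \<subseteq> (\<Union>i\<in>I. alphabet (A i))"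
    and run: "\<And>i. i \<in> I \<Longrightarrow> weak_run (A i) (x i) (filter (\<lambda>\<sigma>. \<sigma> \<in> alphabet (A i)) s) (y i)"
  shows "weak_run (sync I A) x s y"
  using x s run
proof (induction s arbitrary: x)
  case Nil
  then show ?case using weak_run_sync_Nil[OF assms(1) closed _ y] by simp
next
  case (Cons \<sigma> s)
  \<comment> \<open>A component without \<open>\<sigma>\<close> in its alphabet waits, with
    \<open>u\<close> and \<open>v\<close> both equal to \<open>x i\<close>.\<close>
  have "\<exists>u v. weak_run (A i) (x i) [] u \<and>
      (if \<sigma> \<in> alphabet (A i) then (u, Some \<sigma>, v) \<in> transitions (A i) else v = u) \<and>
      weak_run (A i) v (filter (\<lambda>\<sigma>. \<sigma> \<in> alphabet (A i)) s) (y i)" if "i \<in> I" for i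
  proof (cases "\<sigma> \<in> alphabet (A i)")
    case True
    with Cons.prems(3)[OF that] show ?thesis by (fastforce elim!: weak_run_ConsE)
  next
    case False
    with Cons.prems(3)[OF that] show ?thesis using weak_run_refl by force
  qed
  then obtain u v where
    uv: "\<And>i. i \<in> I \<Longrightarrow> weak_run (A i) (x i) [] (u i)"
        "\<And>i. i \<in> I \<Longrightarrow> if \<sigma> \<in> alphabet (A i) then (u i, Some \<sigma>, v i) \<in> transitions (A i)
            else v i = u i"
        "\<And>i. i \<in> I \<Longrightarrow> weak_run (A i) (v i) (filter (\<lambda>\<sigma>. \<sigma> \<in> alphabet (A i)) s) (y i)"
    by metis
  let ?u = "restrict u I" and ?v = "restrict v I"
  have u_st: "u i \<in> states (A i)" if "i \<in> I" for i
    using uv(1)[OF that] closed[OF that] Cons.prems(1) that by (auto intro: weak_run_states)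
  then have v_st: "v i \<in> states (A i)" if "i \<in> I" for i
    using uv(2)[OF that] closed[OF that] that
    by (force simp: closed_transitions_def split: if_splits)
  have "weak_run (sync I A) x [] ?u"
    using u_st uv(1) Cons.prems(1) by (intro weak_run_sync_Nil assms(1) closed) auto
  moreover have "(?u, Some \<sigma>, ?v) \<in> transitions (sync I A)"
    using u_st v_st uv(2) Cons.prems(2) by (auto simp: sync_def)
  moreover have "weak_run (sync I A) ?v s y"
    using v_st uv(3) Cons.prems(2) by (intro Cons.IH) auto
  ultimately show ?case
    using weak_run_trans[of "sync I A" x "[]"] weak_run_event by fastforce
qed

subsection \<open>Opacity\<close>

text \<open>Projecting one global string gives each component its own observer input, and the
  closing event survives only where it is that component's \<open>\<psi>\<close>.\<close>

lemma filter_psi_alphabet: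
  fixes G :: "('e, 'q) automaton" and P :: "('q set \<times> 'q set) set"
  defines "\<Gamma> \<equiv> \<lambda>\<psi>. alphabet (psi_automaton (two_way_observer G) P \<psi>)"
  shows "filter (\<lambda>e. e \<in> \<Gamma> \<psi>) (map Inl (map Delta s @ map Delta_R t) @ [Inr \<phi>]) =
    map Inl (map Delta (filter (\<lambda>\<sigma>. \<sigma> \<in> alphabet G) s) @
      map Delta_R (filter (\<lambda>\<sigma>. \<sigma> \<in> alphabet G) t)) @ (if \<phi> = \<psi> then [Inr \<phi>] else [])"
proof -
  have "Inl (Delta \<sigma>) \<in> \<Gamma> \<psi> \<longleftrightarrow> \<sigma> \<in> alphabet G" "Inl (Delta_R \<sigma>) \<in> \<Gamma> \<psi> \<longleftrightarrow> \<sigma> \<in> alphabet G"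
    "Inr \<phi> \<in> \<Gamma> \<psi> \<longleftrightarrow> \<phi> = \<psi>" for \<sigma>
    by (auto simp: \<Gamma>_def psi_automaton_def alphabet_two_way_observer Delta_def Delta_R_def)
  then show ?thesis by (simp add: filter_map o_def)
qed

theorem theorem6:
  fixes n :: nat
    and G :: "nat \<Rightarrow> ('e, 'q) automaton"
    and QS :: "nat \<Rightarrow> 'q set"
    and \<psi> :: "nat \<Rightarrow> 'p"
  assumes "\<And>i. i \<in> {1..n} \<Longrightarrow> is_automaton (G i)"
    and "\<And>i. i \<in> {1..n} \<Longrightarrow> QS i \<subseteq> states (G i)"
    and "inj_on \<psi> {1..n}"
    and "nonblocking (sync {1..n}
           (\<lambda>i. psi_automaton (two_way_observer (G i)) (psi_states (G i) (QS i)) (\<psi> i)))"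
  shows "infinite_step_opaque (sync {1..n} G) (secret_or {1..n} G QS)"
  unfolding infinite_step_opaque_def
proof (intro ballI impI, elim conjE)
  let ?I = "{1..n}"
  let ?D = "\<lambda>i. two_way_observer (G i)"
  let ?H = "\<lambda>i. psi_automaton (?D i) (psi_states (G i) (QS i)) (\<psi> i)"
  have closed: "closed_transitions (G i)" and init: "initial (G i) \<subseteq> states (G i)"
    if "i \<in> ?I" for i
    using assms(1)[OF that] by (auto simp: is_automaton_closed_transitions is_automaton_def)
  have closed_H: "closed_transitions (?H i)" if "i \<in> ?I" for i
    using closed[OF that]
    by (intro closed_transitions_psi_automaton closed_transitions_two_way_observer)
      (auto simp: psi_states_def)
  fix q0 s t
  assume q0: "q0 \<in> initial (sync ?I G)"
    and s: "s \<in> lists (alphabet (sync ?I G))" and t: "t \<in> lists (alphabet (sync ?I G))"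
    and "s @ t \<in> language (sync ?I G) q0"
  then obtain m z where m: "weak_run (sync ?I G) q0 s m" "weak_run (sync ?I G) m t z"
    by (auto simp: language_def weak_run_append_iff)
  define S where "S i = filter (\<lambda>\<sigma>. \<sigma> \<in> alphabet (G i)) s" for i
  define T where "T i = filter (\<lambda>\<sigma>. \<sigma> \<in> alphabet (G i)) t" for i
  define X where "X i = estimate (G i) (S i)" for i
  define XR where "XR i = estimate (reversed (G i)) (rev (T i))" for i
  \<comment> \<open>The intermediate state of the given run shows that both estimates are nonempty,
    so the observer run exists.\<close>
  have mX: "m i \<in> X i" and mXR: "m i \<in> XR i" if "i \<in> ?I" for i
  proof -
    have runs: "weak_run (G i) (q0 i) (S i) (m i)" "weak_run (G i) (m i) (T i) (z i)"
      unfolding S_def T_def using m that by (auto intro: weak_run_sync_project)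
    have q0i: "q0 i \<in> initial (G i)" using q0 that by (auto simp: sync_def)
    with runs show "m i \<in> X i" by (auto simp: X_def estimate_def)
    have "z i \<in> states (G i)"
      using runs q0i init[OF that] closed[OF that] by (meson subsetD weak_run_states)
    with runs show "m i \<in> XR i" by (auto simp: XR_def estimate_reversed)
  qed
  let ?start = "\<lambda>i. (estimate (G i) [], estimate (reversed (G i)) [])"
  have run_D: "weak_run (?D i) (?start i) (map Delta (S i) @ map Delta_R (rev (T i))) (X i, XR i)"
    if "i \<in> ?I" for i
    unfolding X_def XR_def
    using mX[OF that] mXR[OF that]
    by (intro weak_run_two_way_observer closed init that) (auto simp: S_def T_def X_def XR_def)
  have start_states: "?start i \<in> states (?D i)" if "i \<in> ?I" for i
    by (intro initial_two_way_observer_states closed init that)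
  have X_states: "(X i, XR i) \<in> states (?D i)" if "i \<in> ?I" for i
    by (rule weak_run_states[OF run_D[OF that]
          closed_transitions_two_way_observer[OF closed[OF that]] start_states[OF that]])
  have not_psi: "\<not> X k \<inter> XR k \<subseteq> QS k" if k: "k \<in> ?I" for k
  proof
    assume "X k \<inter> XR k \<subseteq> QS k"
    then have psi: "(X k, XR k) \<in> psi_states (G k) (QS k)"
      using X_states[OF k] by (simp add: psi_states_def)
    \<comment> \<open>A single string for all observers: \<open>s\<close> forwards, \<open>t\<close>
      backwards, then \<open>\<psi> k\<close>. It leads to \<open>?y\<close>, where only component
      \<open>k\<close> is at \<open>\<bottom>\<close>.\<close>
    let ?w = "map Inl (map Delta s @ map Delta_R (rev t)) @ [Inr (\<psi> k)]"
    let ?x = "restrict (\<lambda>i. Some (?start i)) ?I"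
    let ?y = "restrict (\<lambda>i. if i = k then None else Some (X i, XR i)) ?I"
    have run: "weak_run (?H i) (?x i) (filter (\<lambda>e. e \<in> alphabet (?H i)) ?w) (?y i)"
      if i: "i \<in> ?I" for i
    proof -
      have H: "weak_run (?H i) (Some (?start i)) (map Inl (map Delta (S i) @ map Delta_R (rev (T i))))
          (Some (X i, XR i))"
        by (rule weak_run_psi_automaton[OF run_D[OF i]])
      have w: "filter (\<lambda>e. e \<in> alphabet (?H i)) ?w =
          map Inl (map Delta (S i) @ map Delta_R (rev (T i))) @
            (if \<psi> k = \<psi> i then [Inr (\<psi> k)] else [])"
        unfolding filter_psi_alphabet S_def T_def rev_filter ..
      show ?thesis
      proof (cases "i = k")
        case True
        have "weak_run (?H k) (Some (X k, XR k)) [Inr (\<psi> k)] None"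
          using psi by (intro weak_run_event[of _ _ None]) (auto simp: psi_automaton_def)
        with H True i show ?thesis
          unfolding w by (auto simp del: map_append intro: weak_run_trans)
      next
        case False
        \<comment> \<open>Distinctness of the new events lets every other component ignore
          \<open>\<psi> k\<close>.\<close>
        then have "\<psi> k \<noteq> \<psi> i" using assms(3) i k by (auto dest: inj_onD)
        with H False i show ?thesis unfolding w by simp
      qed
    qed
    have "weak_run (sync ?I ?H) ?x ?w ?y"
    proof (rule weak_run_sync[OF _ closed_H _ _ _ run])
      show "set ?w \<subseteq> (\<Union>i\<in>?I. alphabet (?H i))"
        using s t k
        by (fastforce simp: psi_automaton_def alphabet_two_way_observer sync_def)
      show "?x \<in> (\<Pi>\<^sub>E i\<in>?I. states (?H i))" "?y \<in> (\<Pi>\<^sub>E i\<in>?I. states (?H i))"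
        using start_states X_states by (auto simp: psi_automaton_def)
    qed auto
    moreover have "?x \<in> initial (sync ?I ?H)"
      by (auto simp: sync_def psi_automaton_def initial_two_way_observer)
    ultimately have "?y \<in> reachable_states (sync ?I ?H)"
      by (auto simp: reachable_states_iff_weak_run)
    then obtain y' v where y': "y' \<in> marked (sync ?I ?H)" "weak_run (sync ?I ?H) ?y v y'"
      using assms(4) unfolding nonblocking_def weak_run_def by blast
    \<comment> \<open>Component \<open>k\<close> is stuck at \<open>\<bottom>\<close>, whereas every
      entry of a marked tuple is an original observer state.\<close>
    from weak_run_sync_project[OF y'(2) k] have "y' k = None"
      using k by (auto dest: weak_run_psi_automaton_None)
    moreover have "y' k \<in> Some ` states (?D k)"
      using y'(1) k by (simp add: sync_def psi_automaton_def PiE_iff)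
    ultimately show False by auto
  qed
  \<comment> \<open>A state of \<open>X i \<inter> XR i\<close> outside \<open>QS i\<close> serves
    as \<open>y\<close>; membership in the two estimates supplies \<open>p\<close> and
    \<open>z\<close>.\<close>
  have "\<exists>p y z. p \<in> initial (G i) \<and> weak_run (G i) p (S i) y \<and> y \<notin> QS i \<and>
      weak_run (G i) y (T i) z \<and> z \<in> states (G i)" if "i \<in> ?I" for i
    using not_psi[OF that] unfolding X_def XR_def estimate_reversed
    unfolding estimate_def by blast
  then obtain p y z where pyz: "\<And>i. i \<in> ?I \<Longrightarrow> p i \<in> initial (G i)"
    "\<And>i. i \<in> ?I \<Longrightarrow> weak_run (G i) (p i) (S i) (y i)" "\<And>i. i \<in> ?I \<Longrightarrow> y i \<notin> QS i"
    "\<And>i. i \<in> ?I \<Longrightarrow> weak_run (G i) (y i) (T i) (z i)" "\<And>i. i \<in> ?I \<Longrightarrow> z i \<in> states (G i)"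
    by metis
  let ?p = "restrict p ?I" and ?y = "restrict y ?I" and ?z = "restrict z ?I"
  have p_st: "p i \<in> states (G i)" and y_st: "y i \<in> states (G i)" if "i \<in> ?I" for i
    using pyz(1,2)[OF that] init[OF that] closed[OF that] by (meson subsetD weak_run_states)+
  have "?p \<in> initial (sync ?I G)" using pyz(1) by (simp add: sync_def)
  \<comment> \<open>Under \<open>secret_or\<close> a tuple is nonsecret exactly when all its entries
    are, so the separate choices fit together.\<close>
  moreover have "?y \<in> states (sync ?I G) - secret_or ?I G QS"
    using y_st pyz(3) by (auto simp: secret_or_def sync_def)
  moreover have "weak_run (sync ?I G) ?p s ?y"
    using s p_st y_st pyz(2) closed by (intro weak_run_sync) (auto simp: sync_def S_def)
  moreover have "weak_run (sync ?I G) ?y t ?z"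
    using t y_st pyz(4,5) closed by (intro weak_run_sync) (auto simp: sync_def T_def)
  ultimately show "\<exists>q0'\<in>initial (sync ?I G). \<exists>y\<in>states (sync ?I G) - secret_or ?I G QS.
      weak_run (sync ?I G) q0' s y \<and> (\<exists>z. weak_run (sync ?I G) y t z)"
    by blast
qed

end
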